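(* Let $G$ be a finite group and let $\rho$ be a faithful, absolutely irreducible integral representation of $G$ on a $\mathbb{Z}G$-module $L$ (a free $\mathbb Z$-module of finite rank $n$), with real span $U=L\otimes\mathbb R$ and complex span $V=L\otimes\mathbb C$. Then every $\rho$-decomposable principally polarized abelian variety is isomorphic, as a principally polarized abelian variety, to $$X(B,\tau) = V/(L+\tau L^{*}),\qquad \Im H(u+\tau u', v+\tau v') = B(u,v') - B(v,u')\quad (u,u',v,v'\in U),$$ for some $\rho(G)$-invariant real inner product $B$ on $U$ that is integral on $L$ and some complex number $\tau$ with positive imaginary part, where $L^{*}$ is the dual of $L$ with respect to $B$.
   Context: A principally polarized abelian variety (p.p.a.v.) of dimension $n$ is a pair $(X,H)$, where $X=V/\Lambda$ is a complex torus ($V$ a complex vector space of dimension $n$, $\Lambda\subset V$ a lattice of rank $2n$) and $H$ is a positive definite Hermitian form on $V$ whose imaginary part $\Im H$ is integer valued and unimodular on $\Lambda$. Hermitian forms are taken complex linear in the second variable and conjugate linear in the first. Two p.p.a.v.'s are isomorphic as principally polarized abelian varieties if there is an isomorphism of complex tori between them that preserves the polarizations. A p.p.a.v. $(X,H)$ has a $G$-action if $G$ is a subgroup of the group $\mathrm{Aut}_H(X)$ of automorphisms of the complex torus $X$ preserving $H$; then $G$ acts on $\Lambda$. A decomposition for $H$ is a direct sum $\Lambda = L_1\oplus L_2$ with $L_1$, $L_2$ isotropic for $\Im H$; equivalently, there is a symplectic basis $\lambda_1,\dots,\lambda_n,\mu_1,\dots,\mu_n$ of $\Lambda$ such that $L_1=\langle\lambda_1,\dots,\lambda_n\rangle$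 and $L_2=\langle\mu_1,\dots,\mu_n\rangle$. For a faithful integral representation $\rho$ of $G$ and a p.p.a.v. with $G$-action, it is a $\rho$-decomposition if $L_1$ and $L_2$ are both $G$-invariant and $L_1$ is $\mathbb{Z}G$-equivalent (isomorphic as a $\mathbb ZG$-module) to $\rho$. A p.p.a.v. is $\rho$-decomposable if it has a $G$-action admitting a $\rho$-decomposition. $B$ is integral on $L$ if $B(L,L)\subset\mathbb Z$, and $L^{*}=\{u\in U : B(u,\ell)\in\mathbb Z \text{ for all } \ell\in L\}$. *)

theory Defs
  imports "HOL-Analysis.Analysis" "HOL-Algebra.Group"
begin

text \<open>
  Complex vector spaces are given by a type of class \<open>ab_group_add\<close> together with a scalar
  multiplication \<open>s\<close> satisfying \<^locale>\<open>vector_space\<close>; the whole type is the space.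
  Restricting the scalars of \<open>s\<close> gives the underlying real vector space and the underlying
  abelian group, so that \<open>module.span (rscale s)\<close> is the real span, \<open>module.span (zscale s)\<close> the
  subgroup generated, and \<open>module.subspace (zscale s)\<close> means additive subgroup.
\<close>

definition rscale :: "(complex \<Rightarrow> 'v \<Rightarrow> 'v) \<Rightarrow> real \<Rightarrow> 'v \<Rightarrow> 'v" where
  "rscale s r = s (complex_of_real r)"

definition zscale :: "(complex \<Rightarrow> 'v \<Rightarrow> 'v) \<Rightarrow> int \<Rightarrow> 'v \<Rightarrow> 'v" where
  "zscale s k = s (complex_of_int k)"


subsection \<open>Principally polarized abelian varieties\<close>

text \<open>Conjugate linearity in the first variable follows from the last clause.\<close>

definition hermitian_form ::
  "(complex \<Rightarrow> 'v \<Rightarrow> 'v) \<Rightarrow> ('v::ab_group_add \<Rightarrow> 'v \<Rightarrow> complex) \<Rightarrow> bool" where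
  "hermitian_form s H \<longleftrightarrow>
     (\<forall>x y z. H x (y + z) = H x y + H x z) \<and>
     (\<forall>c x y. H x (s c y) = c * H x y) \<and>
     (\<forall>x y. H y x = cnj (H x y))"

definition pos_def_form :: "('v::ab_group_add \<Rightarrow> 'v \<Rightarrow> complex) \<Rightarrow> bool" where
  "pos_def_form H \<longleftrightarrow> (\<forall>x. x \<noteq> 0 \<longrightarrow> Re (H x x) > 0)"

definition lattice_of_rank ::
  "(complex \<Rightarrow> 'v \<Rightarrow> 'v) \<Rightarrow> nat \<Rightarrow> 'v::ab_group_add set \<Rightarrow> bool" where
  "lattice_of_rank s k \<Lambda> \<longleftrightarrow>
     (\<exists>S. finite S \<and> card S = k \<and> \<not> module.dependent (rscale s) S \<and>
          module.span (rscale s) S = UNIV \<and> \<Lambda> = module.span (zscale s) S)"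

definition integral_on :: "'v set \<Rightarrow> ('v \<Rightarrow> 'v \<Rightarrow> real) \<Rightarrow> bool" where
  "integral_on L E \<longleftrightarrow> (\<forall>x\<in>L. \<forall>y\<in>L. E x y \<in> \<int>)"

text \<open>Unimodular: \<open>x \<mapsto> E x\<close> is a bijection from \<open>\<Lambda>\<close> onto its dual group of integer valued
  additive functions.\<close>

definition unimodular_on :: "'v::ab_group_add set \<Rightarrow> ('v \<Rightarrow> 'v \<Rightarrow> real) \<Rightarrow> bool" where
  "unimodular_on \<Lambda> E \<longleftrightarrow>
     integral_on \<Lambda> E \<and>
     (\<forall>f :: 'v \<Rightarrow> int. (\<forall>y\<in>\<Lambda>. \<forall>z\<in>\<Lambda>. f (y + z) = f y + f z) \<longrightarrow>
        (\<exists>!x. x \<in> \<Lambda> \<and> (\<forall>y\<in>\<Lambda>. E x y = real_of_int (f y))))"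

text \<open>\<open>ppav s n \<Lambda> H\<close>: the torus \<open>V/\<Lambda>\<close>, where \<open>V\<close> is the space with scalar multiplication \<open>s\<close>,
  with the form \<open>H\<close> is a p.p.a.v. of dimension \<open>n\<close>.\<close>

definition ppav ::
  "(complex \<Rightarrow> 'v \<Rightarrow> 'v) \<Rightarrow> nat \<Rightarrow> 'v::ab_group_add set \<Rightarrow> ('v \<Rightarrow> 'v \<Rightarrow> complex) \<Rightarrow> bool" where
  "ppav s n \<Lambda> H \<longleftrightarrow>
     vector_space s \<and> vector_space.dim s UNIV = n \<and> lattice_of_rank s (2 * n) \<Lambda> \<and>
     hermitian_form s H \<and> pos_def_form H \<and> unimodular_on \<Lambda> (\<lambda>x y. Im (H x y))"

text \<open>Isomorphisms of complex tori (as complex Lie groups) \<open>V/\<Lambda> \<rightarrow> V'/\<Lambda>'\<close> are represented by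
  their lifts, the complex linear isomorphisms \<open>V \<rightarrow> V'\<close> mapping \<open>\<Lambda>\<close> onto \<open>\<Lambda>'\<close>; the lift is
  uniquely determined.\<close>

definition ppav_iso_map ::
  "(complex \<Rightarrow> 'v \<Rightarrow> 'v) \<Rightarrow> 'v::ab_group_add set \<Rightarrow> ('v \<Rightarrow> 'v \<Rightarrow> complex) \<Rightarrow>
   (complex \<Rightarrow> 'w \<Rightarrow> 'w) \<Rightarrow> 'w::ab_group_add set \<Rightarrow> ('w \<Rightarrow> 'w \<Rightarrow> complex) \<Rightarrow>
   ('v \<Rightarrow> 'w) \<Rightarrow> bool" where
  "ppav_iso_map s \<Lambda> H s' \<Lambda>' H' \<phi> \<longleftrightarrow>
     Vector_Spaces.linear s s' \<phi> \<and> bij \<phi> \<and> \<phi> ` \<Lambda> = \<Lambda>' \<and>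
     (\<forall>x y. H' (\<phi> x) (\<phi> y) = H x y)"

definition ppav_isomorphic ::
  "(complex \<Rightarrow> 'v \<Rightarrow> 'v) \<Rightarrow> 'v::ab_group_add set \<Rightarrow> ('v \<Rightarrow> 'v \<Rightarrow> complex) \<Rightarrow>
   (complex \<Rightarrow> 'w \<Rightarrow> 'w) \<Rightarrow> 'w::ab_group_add set \<Rightarrow> ('w \<Rightarrow> 'w \<Rightarrow> complex) \<Rightarrow> bool" where
  "ppav_isomorphic s \<Lambda> H s' \<Lambda>' H' \<longleftrightarrow> (\<exists>\<phi>. ppav_iso_map s \<Lambda> H s' \<Lambda>' H' \<phi>)"

definition ppav_Aut ::
  "(complex \<Rightarrow> 'v \<Rightarrow> 'v) \<Rightarrow> 'v::ab_group_add set \<Rightarrow> ('v \<Rightarrow> 'v \<Rightarrow> complex) \<Rightarrow>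
   ('v \<Rightarrow> 'v) monoid" where
  "ppav_Aut s \<Lambda> H =
     \<lparr>carrier = {\<phi>. ppav_iso_map s \<Lambda> H s \<Lambda> H \<phi>}, mult = (\<circ>), one = id\<rparr>"

text \<open>A \<open>G\<close>-action realizes \<open>G\<close> as a subgroup of the automorphism group.\<close>

definition ppav_action ::
  "('g, 'b) monoid_scheme \<Rightarrow> (complex \<Rightarrow> 'v \<Rightarrow> 'v) \<Rightarrow> 'v::ab_group_add set \<Rightarrow>
   ('v \<Rightarrow> 'v \<Rightarrow> complex) \<Rightarrow> ('g \<Rightarrow> 'v \<Rightarrow> 'v) \<Rightarrow> bool" where
  "ppav_action G s \<Lambda> H \<alpha> \<longleftrightarrow> \<alpha> \<in> hom G (ppav_Aut s \<Lambda> H) \<and> inj_on \<alpha> (carrier G)"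


subsection \<open>Integral representations\<close>

text \<open>\<open>L\<close> is free of rank \<open>n\<close> over the integers, and the ambient complex space is
  \<open>L \<otimes> \<complex>\<close>: a \<open>\<int>\<close>-basis of \<open>L\<close> is a \<open>\<complex>\<close>-basis of the space.\<close>

definition integral_structure ::
  "(complex \<Rightarrow> 'v \<Rightarrow> 'v) \<Rightarrow> nat \<Rightarrow> 'v::ab_group_add set \<Rightarrow> bool" where
  "integral_structure s n L \<longleftrightarrow>
     vector_space s \<and>
     (\<exists>S. finite S \<and> card S = n \<and> \<not> module.dependent s S \<and>
          module.span s S = UNIV \<and> L = module.span (zscale s) S)"

text \<open>Automorphisms of the abelian group \<open>L\<close>, identified with their complex linear extensions
  to \<open>L \<otimes> \<complex>\<close>.\<close>

definition lattice_Aut ::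
  "(complex \<Rightarrow> 'v \<Rightarrow> 'v) \<Rightarrow> 'v::ab_group_add set \<Rightarrow> ('v \<Rightarrow> 'v) monoid" where
  "lattice_Aut s L =
     \<lparr>carrier = {\<phi>. Vector_Spaces.linear s s \<phi> \<and> bij \<phi> \<and> \<phi> ` L = L}, mult = (\<circ>), one = id\<rparr>"

definition integral_representation ::
  "('g, 'b) monoid_scheme \<Rightarrow> (complex \<Rightarrow> 'v \<Rightarrow> 'v) \<Rightarrow> nat \<Rightarrow> 'v::ab_group_add set \<Rightarrow>
   ('g \<Rightarrow> 'v \<Rightarrow> 'v) \<Rightarrow> bool" where
  "integral_representation G s n L \<rho> \<longleftrightarrow>
     integral_structure s n L \<and> \<rho> \<in> hom G (lattice_Aut s L)"

definition faithful_rep :: "('g, 'b) monoid_scheme \<Rightarrow> ('g \<Rightarrow> 'v \<Rightarrow> 'v) \<Rightarrow> bool" where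
  "faithful_rep G \<rho> \<longleftrightarrow> inj_on \<rho> (carrier G)"

text \<open>Irreducibility of \<open>L \<otimes> \<complex>\<close>.\<close>

definition absolutely_irreducible ::
  "('g, 'b) monoid_scheme \<Rightarrow> (complex \<Rightarrow> 'v \<Rightarrow> 'v) \<Rightarrow> ('g \<Rightarrow> 'v::ab_group_add \<Rightarrow> 'v) \<Rightarrow> bool"
  where
  "absolutely_irreducible G s \<rho> \<longleftrightarrow>
     (UNIV :: 'v set) \<noteq> {0} \<and>
     (\<forall>W. module.subspace s W \<and> (\<forall>g\<in>carrier G. \<rho> g ` W \<subseteq> W) \<longrightarrow> W = {0} \<or> W = UNIV)"

definition ZG_isomorphic ::
  "('g, 'b) monoid_scheme \<Rightarrow> 'v::ab_group_add set \<Rightarrow> ('g \<Rightarrow> 'v \<Rightarrow> 'v) \<Rightarrow>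
   'w::ab_group_add set \<Rightarrow> ('g \<Rightarrow> 'w \<Rightarrow> 'w) \<Rightarrow> bool" where
  "ZG_isomorphic G L \<rho> M \<alpha> \<longleftrightarrow>
     (\<exists>f. bij_betw f L M \<and> (\<forall>x\<in>L. \<forall>y\<in>L. f (x + y) = f x + f y) \<and>
          (\<forall>g\<in>carrier G. \<forall>x\<in>L. f (\<rho> g x) = \<alpha> g (f x)))"


subsection \<open>Decompositions\<close>

definition isotropic_on :: "'v set \<Rightarrow> ('v \<Rightarrow> 'v \<Rightarrow> real) \<Rightarrow> bool" where
  "isotropic_on L E \<longleftrightarrow> (\<forall>x\<in>L. \<forall>y\<in>L. E x y = 0)"

definition decomposition ::
  "(complex \<Rightarrow> 'v \<Rightarrow> 'v) \<Rightarrow> 'v::ab_group_add set \<Rightarrow> ('v \<Rightarrow> 'v \<Rightarrow> complex) \<Rightarrow>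
   'v set \<Rightarrow> 'v set \<Rightarrow> bool" where
  "decomposition s \<Lambda> H L1 L2 \<longleftrightarrow>
     module.subspace (zscale s) L1 \<and> module.subspace (zscale s) L2 \<and>
     \<Lambda> = {x + y |x y. x \<in> L1 \<and> y \<in> L2} \<and> L1 \<inter> L2 = {0} \<and>
     isotropic_on L1 (\<lambda>x y. Im (H x y)) \<and> isotropic_on L2 (\<lambda>x y. Im (H x y))"

definition rho_decomposition ::
  "('g, 'b) monoid_scheme \<Rightarrow> 'v::ab_group_add set \<Rightarrow> ('g \<Rightarrow> 'v \<Rightarrow> 'v) \<Rightarrow>
   (complex \<Rightarrow> 'w \<Rightarrow> 'w) \<Rightarrow> 'w::ab_group_add set \<Rightarrow> ('w \<Rightarrow> 'w \<Rightarrow> complex) \<Rightarrow>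
   ('g \<Rightarrow> 'w \<Rightarrow> 'w) \<Rightarrow> 'w set \<Rightarrow> 'w set \<Rightarrow> bool" where
  "rho_decomposition G L \<rho> s \<Lambda> H \<alpha> L1 L2 \<longleftrightarrow>
     decomposition s \<Lambda> H L1 L2 \<and>
     (\<forall>g\<in>carrier G. \<alpha> g ` L1 \<subseteq> L1) \<and> (\<forall>g\<in>carrier G. \<alpha> g ` L2 \<subseteq> L2) \<and>
     ZG_isomorphic G L \<rho> L1 \<alpha>"

definition rho_decomposable ::
  "('g, 'b) monoid_scheme \<Rightarrow> 'v::ab_group_add set \<Rightarrow> ('g \<Rightarrow> 'v \<Rightarrow> 'v) \<Rightarrow>
   (complex \<Rightarrow> 'w \<Rightarrow> 'w) \<Rightarrow> 'w::ab_group_add set \<Rightarrow> ('w \<Rightarrow> 'w \<Rightarrow> complex) \<Rightarrow> bool" where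
  "rho_decomposable G L \<rho> s \<Lambda> H \<longleftrightarrow>
     (\<exists>\<alpha> L1 L2. ppav_action G s \<Lambda> H \<alpha> \<and> rho_decomposition G L \<rho> s \<Lambda> H \<alpha> L1 L2)"


subsection \<open>The varieties \<open>X(B,\<tau>)\<close>\<close>

definition real_span :: "(complex \<Rightarrow> 'v \<Rightarrow> 'v) \<Rightarrow> 'v::ab_group_add set \<Rightarrow> 'v set" where
  "real_span s L = module.span (rscale s) L"

text \<open>Only the values of \<open>B\<close> on \<open>U\<close> matter.\<close>

definition inner_product_on ::
  "(complex \<Rightarrow> 'v \<Rightarrow> 'v) \<Rightarrow> 'v::ab_group_add set \<Rightarrow> ('v \<Rightarrow> 'v \<Rightarrow> real) \<Rightarrow> bool" where
  "inner_product_on s U B \<longleftrightarrow>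
     (\<forall>u\<in>U. \<forall>v\<in>U. \<forall>w\<in>U. B (u + v) w = B u w + B v w) \<and>
     (\<forall>r. \<forall>u\<in>U. \<forall>v\<in>U. B (rscale s r u) v = r * B u v) \<and>
     (\<forall>u\<in>U. \<forall>v\<in>U. B u v = B v u) \<and>
     (\<forall>u\<in>U. u \<noteq> 0 \<longrightarrow> B u u > 0)"

definition invariant_form ::
  "('g, 'b) monoid_scheme \<Rightarrow> ('g \<Rightarrow> 'v \<Rightarrow> 'v) \<Rightarrow> 'v set \<Rightarrow> ('v \<Rightarrow> 'v \<Rightarrow> real) \<Rightarrow> bool" where
  "invariant_form G \<rho> U B \<longleftrightarrow>
     (\<forall>g\<in>carrier G. \<forall>u\<in>U. \<forall>v\<in>U. B (\<rho> g u) (\<rho> g v) = B u v)"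

definition dual_lattice ::
  "(complex \<Rightarrow> 'v \<Rightarrow> 'v) \<Rightarrow> ('v \<Rightarrow> 'v \<Rightarrow> real) \<Rightarrow> 'v::ab_group_add set \<Rightarrow> 'v set" where
  "dual_lattice s B L = {u \<in> real_span s L. \<forall>l\<in>L. B u l \<in> \<int>}"

definition X_lattice ::
  "(complex \<Rightarrow> 'v \<Rightarrow> 'v) \<Rightarrow> 'v::ab_group_add set \<Rightarrow> ('v \<Rightarrow> 'v \<Rightarrow> real) \<Rightarrow> complex \<Rightarrow> 'v set" where
  "X_lattice s L B \<tau> = {l + s \<tau> l' |l l'. l \<in> L \<and> l' \<in> dual_lattice s B L}"

text \<open>The equation determines the Hermitian form \<open>H\<close>: since \<open>V = U \<oplus> \<tau>U\<close> it gives \<open>Im H\<close> on all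
  of \<open>V\<close>, and \<open>Re (H x y) = Im (H x (\<i> y))\<close>.\<close>

definition X_form ::
  "(complex \<Rightarrow> 'v \<Rightarrow> 'v) \<Rightarrow> 'v::ab_group_add set \<Rightarrow> ('v \<Rightarrow> 'v \<Rightarrow> real) \<Rightarrow> complex \<Rightarrow>
   ('v \<Rightarrow> 'v \<Rightarrow> complex) \<Rightarrow> bool" where
  "X_form s L B \<tau> H \<longleftrightarrow>
     hermitian_form s H \<and>
     (\<forall>u\<in>real_span s L. \<forall>u'\<in>real_span s L. \<forall>v\<in>real_span s L. \<forall>v'\<in>real_span s L.
        Im (H (u + s \<tau> u') (v + s \<tau> v')) = B u v' - B v u')"

end

theory Submission
  imports Defs "HOL-Computational_Algebra.Fundamental_Theorem_Algebra"
begin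

text \<open>
  Let \<open>\<Lambda> = L1 \<oplus> L2\<close> be a \<open>\<rho>\<close>-decomposition of the lattice of a p.p.a.v. \<open>(W/\<Lambda>, H)\<close>, and write \<open>E = Im H\<close>.
  The isomorphism \<open>L \<cong> L1\<close> extends to a complex linear equivariant map \<open>F : L \<otimes> \<complex> \<rightarrow> W\<close>. Its kernel is
  an invariant subspace, so \<open>F\<close> is injective by irreducibility. It is surjective because no nonzero
  vector is \<open>H\<close>-orthogonal to \<open>L1\<close> (\<open>bij_of_inj_covering_isotropic_summand\<close>). Pulling everything back
  along \<open>F\<close>, one may assume \<open>W = L \<otimes> \<complex>\<close> and \<open>L1 = L\<close>.

  Fix any invariant inner product \<open>B\<close> that is integral on \<open>L\<close>
  (\<open>invariant_integral_inner_product\<close>). Since \<open>E\<close> is unimodular and both summands are isotropic, \<open>E\<close>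
  identifies \<open>L2\<close> with the dual group of \<open>L\<close>; so for every \<open>l \<in> L\<close> there is a unique \<open>\<phi> l \<in> L2\<close> with
  \<open>E y (\<phi> l) = B y l\<close> for all \<open>y \<in> L\<close>. All data being invariant, \<open>\<phi>\<close> is equivariant, and by Schur's
  lemma its complex linear extension is a scalar \<open>\<tau>\<close> (\<open>scalar_realising_B\<close>). Thus a single
  application of Schur's lemma yields \<open>E u (\<tau> v) = B u v\<close> on the real span of \<open>L\<close>. This gives the
  formula for the form, positivity of \<open>H\<close> gives \<open>Im \<tau> > 0\<close>, and unimodularity gives \<open>L2 = \<tau> L\<^sup>*\<close>
  (\<open>splitting_eq_X\<close>).
\<close>


section \<open>Eigenvectors and Schur's lemma\<close>

lemma (in vector_space) linear_relation_of_long_sequence: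
  assumes S: "finite S" "span S = UNIV" and N: "card S < N"
  shows "\<exists>a. (\<exists>i<N. a i \<noteq> 0) \<and> (\<Sum>i<N. scale (a i) (v i)) = 0"
proof (cases "inj_on v {..<N}")
  case True
  have "dependent (v ` {..<N})"
    using independent_span_bound[OF S(1), of "v ` {..<N}"] S N card_image[OF True] by auto
  then obtain u where u: "\<exists>x\<in>v ` {..<N}. u x \<noteq> 0" "(\<Sum>x\<in>v ` {..<N}. scale (u x) x) = 0"
    by (auto simp: dependent_finite)
  then have "(\<Sum>i<N. scale (u (v i)) (v i)) = 0"
    by (simp add: sum.reindex[OF True])
  with u(1) show ?thesis by (intro exI[of _ "u \<circ> v"]) auto
next
  case False
  then obtain i j where ij: "i < N" "j < N" "i \<noteq> j" "v i = v j"
    by (auto simp: inj_on_def)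
  define a where "a k = (if k = i then 1 else 0) - (if k = j then 1 else 0 :: 'a)" for k
  have "(\<Sum>k<N. scale (a k) (v k)) = v i - v j"
    using ij by (simp add: a_def scale_left_diff_distrib sum_subtractf if_distrib[of "\<lambda>c. scale c _"] cong: if_cong)
  moreover have "a i \<noteq> 0" using ij by (simp add: a_def)
  ultimately show ?thesis using ij by auto
qed

text \<open>
  A vector \<open>x\<close> and its first iterates under \<open>T\<close> satisfy a linear relation, that is, \<open>p(T) x = 0\<close> for
  some nonzero polynomial \<open>p\<close>. Splitting off a linear factor \<open>X - c\<close> of \<open>p = (X - c) q\<close>, either
  \<open>q(T) x\<close> is an eigenvector for \<open>c\<close> or \<open>q\<close> is a polynomial of smaller degree with the same property.
\<close>
lemma linear_has_eigenvector:
  fixes s :: "complex \<Rightarrow> 'v::ab_group_add \<Rightarrow> 'v" and x :: 'v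
  assumes T: "Vector_Spaces.linear s s T" and S: "finite S" "module.span s S = UNIV"
    and x: "x \<noteq> 0"
  shows "\<exists>c y. y \<noteq> 0 \<and> T y = s c y"
proof -
  interpret T: Vector_Spaces.linear s s T by fact
  define N where "N = Suc (card S)"
  \<comment> \<open>\<open>ev p\<close> is \<open>p(T) x\<close>, for \<open>p\<close> of degree at most \<open>card S\<close>\<close>
  define ev where "ev p = (\<Sum>i<N. s (coeff p i) ((T ^^ i) x))" for p
  obtain a where a: "\<exists>i<N. a i \<noteq> 0" "(\<Sum>i<N. s (a i) ((T ^^ i) x)) = 0"
    using T.vs1.linear_relation_of_long_sequence[OF S, of N "\<lambda>i. (T ^^ i) x"]
    by (auto simp: N_def)
  define p0 where "p0 = (\<Sum>i<N. monom (a i) i)"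
  have c0: "coeff p0 k = (if k < N then a k else 0)" for k
    by (simp add: p0_def coeff_sum coeff_monom)
  have "p0 \<noteq> 0" using a(1) c0 by (metis coeff_0)
  moreover have "degree p0 < N"
  proof (rule ccontr)
    assume "\<not> degree p0 < N"
    then have "lead_coeff p0 = 0" by (simp add: c0)
    with \<open>p0 \<noteq> 0\<close> show False by simp
  qed
  moreover have "ev p0 = 0" using a(2) by (simp add: ev_def c0)
  ultimately show ?thesis
  proof (induction "degree p0" arbitrary: p0 rule: less_induct)
    case (less p)
    show ?case
    proof (cases "degree p = 0")
      case True
      then have "coeff p i = 0" if "i \<noteq> 0" for i
        using that by (simp add: coeff_eq_0)
      then have "ev p = (\<Sum>i<N. if i = 0 then s (coeff p 0) x else 0)"
        unfolding ev_def by (intro sum.cong) auto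
      then have "ev p = s (coeff p 0) x" by (simp add: N_def)
      with less.prems(3) x have "coeff p 0 = 0" by simp
      with True less.prems(1) show ?thesis by (metis leading_coeff_0_iff)
    next
      case False
      then have "\<not> constant (poly p)" by (simp add: constant_degree)
      then obtain c where "poly p c = 0"
        using fundamental_theorem_of_algebra by blast
      then obtain q where q: "p = [:-c, 1:] * q" by (auto simp: poly_eq_0_iff_dvd elim: dvdE)
      have q0: "q \<noteq> 0" using q less.prems(1) by auto
      have "degree p = degree [:-c, 1:] + degree q"
        unfolding q using q0 by (intro degree_mult_eq) auto
      then have dq: "degree p = Suc (degree q)" by simp
      then have cq: "coeff q (card S) = 0"
        using less.prems(2) by (intro coeff_eq_0) (simp add: N_def)
      have "ev p = (\<Sum>i<N. s (coeff (pCons 0 q) i) ((T ^^ i) x)) - s c (ev q)"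
        by (simp add: q ev_def T.vs1.scale_left_diff_distrib sum_subtractf T.vs1.scale_sum_right)
      also have "(\<Sum>i<N. s (coeff (pCons 0 q) i) ((T ^^ i) x))
          = (\<Sum>i<card S. s (coeff q i) (T ((T ^^ i) x)))"
        by (simp add: N_def sum.lessThan_Suc_shift del: sum.lessThan_Suc)
      also have "\<dots> = T (ev q)"
        using cq by (simp add: ev_def N_def T.sum T.scale T.add)
      finally have "T (ev q) = s c (ev q)" using less.prems(3) by simp
      then show ?thesis
        using less.hyps[of q] less.prems(2) dq q0 by (cases "ev q = 0") auto
    qed
  qed
qed

text \<open>
  Schur's lemma: an eigenspace of a map that commutes with the representation is invariant,
  hence the whole space.
\<close>
lemma schur_scalar:
  fixes s :: "complex \<Rightarrow> 'v::ab_group_add \<Rightarrow> 'v"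
  assumes T: "Vector_Spaces.linear s s T" and S: "finite S" "module.span s S = UNIV"
    and irred: "absolutely_irreducible G s \<rho>"
    and lin: "\<And>g. g \<in> carrier G \<Longrightarrow> Vector_Spaces.linear s s (\<rho> g)"
    and comm: "\<And>g x. g \<in> carrier G \<Longrightarrow> T (\<rho> g x) = \<rho> g (T x)"
  obtains c where "\<And>x. T x = s c x"
proof -
  interpret T: Vector_Spaces.linear s s T by fact
  obtain x :: 'v where "x \<noteq> 0" using irred unfolding absolutely_irreducible_def by blast
  then obtain c y where y: "y \<noteq> 0" "T y = s c y"
    using linear_has_eigenvector[OF T S] by blast
  let ?W = "{x. T x = s c x}"
  have "T.vs1.subspace ?W"
    by (auto simp: T.vs1.subspace_def T.add T.scale T.vs1.scale_right_distrib mult.commute)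
  moreover have "\<rho> g ` ?W \<subseteq> ?W" if g: "g \<in> carrier G" for g
    using comm[OF g] module_hom.scale[OF lin[OF g, unfolded linear_iff_module_hom]] by auto
  ultimately have "?W = {0} \<or> ?W = UNIV"
    using irred unfolding absolutely_irreducible_def by blast
  with y show ?thesis using that by blast
qed

section \<open>Integral structures and extension of scalars\<close>

lemma vector_space_rscale: "vector_space s \<Longrightarrow> vector_space (rscale s)"
  by (simp add: vector_space_def rscale_def)

lemma module_zscale: "vector_space s \<Longrightarrow> module (zscale s)"
  by (simp add: vector_space_def module_def zscale_def)

lemma additive_zscale:
  fixes s :: "complex \<Rightarrow> 'v::ab_group_add \<Rightarrow> 'v" and s' :: "complex \<Rightarrow> 'w::ab_group_add \<Rightarrow> 'w"
  assumes s: "vector_space s" and s': "vector_space s'" and L: "module.subspace (zscale s) L"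
    and add: "\<And>x y. x \<in> L \<Longrightarrow> y \<in> L \<Longrightarrow> f (x + y) = f x + f y" and x: "x \<in> L"
  shows "f (zscale s k x) = zscale s' k (f x)"
proof -
  interpret z: module "zscale s" using s by (rule module_zscale)
  interpret z': module "zscale s'" using s' by (rule module_zscale)
  have f0: "f 0 = 0" using add[of 0 0] z.subspace_0[OF L] by simp
  show ?thesis
  proof (induction k rule: int_induct[of _ 0])
    case base
    show ?case using f0 by simp
  next
    case (step1 i)
    then show ?case
      using add[OF z.subspace_scale[OF L x] x] by (simp add: z.scale_left_distrib z'.scale_left_distrib)
  next
    case (step2 i)
    then show ?case
      using add[OF z.subspace_scale[OF L x, of "i - 1"] x]
      by (simp add: z.scale_left_diff_distrib z'.scale_left_diff_distrib)
  qed
qed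

text \<open>
  The universal property of \<open>L \<otimes> \<complex>\<close>: a \<open>\<int>\<close>-basis of \<open>L\<close> is a \<open>\<complex>\<close>-basis of the ambient space.
\<close>
lemma extend_additive_to_linear:
  fixes s :: "complex \<Rightarrow> 'v::ab_group_add \<Rightarrow> 'v" and s' :: "complex \<Rightarrow> 'w::ab_group_add \<Rightarrow> 'w"
  assumes L: "integral_structure s n L" and s': "vector_space s'"
    and add: "\<And>x y. x \<in> L \<Longrightarrow> y \<in> L \<Longrightarrow> f (x + y) = f x + f y"
  obtains F where "Vector_Spaces.linear s s' F" "\<And>x. x \<in> L \<Longrightarrow> F x = f x"
proof -
  obtain S where s: "vector_space s" and S: "\<not> module.dependent s S" "L = module.span (zscale s) S"
    using L by (auto simp: integral_structure_def)
  interpret vector_space_pair s s' using s s' by (simp add: vector_space_pair_def)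
  interpret z: module "zscale s" using s by (rule module_zscale)
  obtain F where F: "Vector_Spaces.linear s s' F" "\<forall>x\<in>S. F x = f x"
    using linear_independent_extend[OF S(1)] by blast
  interpret F: Vector_Spaces.linear s s' F by fact
  have Lsub: "z.subspace L" by (simp add: S(2))
  have f0: "f 0 = 0" using add[of 0 0] z.subspace_0[OF Lsub] by simp
  have "x \<in> L \<and> F x = f x" if "x \<in> z.span S" for x
    using that
  proof (induction rule: z.span_induct_alt)
    case base
    show ?case using f0 z.subspace_0[OF Lsub] by (simp add: F.zero)
  next
    case (step c x y)
    then have xL: "x \<in> L" by (simp add: S(2) z.span_base)
    have cx: "zscale s c x \<in> L" by (rule z.subspace_scale[OF Lsub xL])
    have "F (zscale s c x + y) = zscale s' c (f x) + f y"
      using step F(2) by (simp add: F.add F.scale zscale_def)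
    also have "\<dots> = f (zscale s c x + y)"
      using add[OF cx] step additive_zscale[OF s s' Lsub add xL, of c] by simp
    finally show ?case using z.subspace_add[OF Lsub cx] step by simp
  qed
  then show thesis using that F(1) S(2) by blast
qed

lemma linear_eq_on_integral_structure:
  assumes L: "integral_structure s n L" and F: "Vector_Spaces.linear s s' F" "Vector_Spaces.linear s s' F'"
    and eq: "\<And>x. x \<in> L \<Longrightarrow> F x = F' x"
  shows "F x = F' x"
proof -
  obtain S where s: "vector_space s" and S: "module.span s S = UNIV" "L = module.span (zscale s) S"
    using L by (auto simp: integral_structure_def)
  interpret z: module "zscale s" using s by (rule module_zscale)
  interpret F: Vector_Spaces.linear s s' F by fact
  interpret vector_space_pair s s' by unfold_locales
  show ?thesis
    by (rule linear_eq_on[OF F, of x S]) (use S eq z.span_base in auto)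
qed

lemma real_functional_zero_on_real_span:
  assumes s: "vector_space s"
    and add: "\<And>x y. f (x + y) = f x + f y" and scale: "\<And>r x. f (rscale s r x) = r * f x"
    and L: "\<And>x. x \<in> L \<Longrightarrow> f x = (0::real)" and x: "x \<in> real_span s L"
  shows "f x = 0"
proof -
  interpret r: vector_space "rscale s" using s by (rule vector_space_rscale)
  have "f 0 = 0" using scale[of 0 0] by simp
  then have "r.subspace {x. f x = 0}" by (auto simp: r.subspace_def add scale)
  then have "real_span s L \<subseteq> {x. f x = 0}"
    unfolding real_span_def by (intro r.span_minimal) (auto simp: L)
  then show ?thesis using x by auto
qed

section \<open>An invariant integral inner product\<close>

text \<open>
  Sum the translates under the group of the standard Hermitian form of a \<open>\<int>\<close>-basis of \<open>L\<close>; the sum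
  is not divided by the order of the group, so that it stays integral on \<open>L\<close>. Its real part is an
  inner product on the whole underlying real space, hence also on the real span of \<open>L\<close>.
\<close>
lemma invariant_integral_inner_product:
  fixes s :: "complex \<Rightarrow> 'v::ab_group_add \<Rightarrow> 'v"
  assumes "group G" and fin: "finite (carrier G)" and rep: "integral_representation G s n L \<rho>"
  obtains B where "inner_product_on s UNIV B" "invariant_form G \<rho> UNIV B" "integral_on L B"
proof -
  interpret group G by fact
  obtain S where s: "vector_space s" and S: "finite S" "\<not> module.dependent s S"
      "module.span s S = UNIV" "L = module.span (zscale s) S"
    using rep by (auto simp: integral_representation_def integral_structure_def)
  interpret vector_space s by fact
  interpret z: module "zscale s" using s by (rule module_zscale)
  have lin: "Vector_Spaces.linear s s (\<rho> g)" and pres: "\<rho> g ` L = L" if "g \<in> carrier G" for g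
    using rep that by (auto simp: integral_representation_def lattice_Aut_def hom_def Pi_def)
  have mult: "\<rho> (h \<otimes>\<^bsub>G\<^esub> g) x = \<rho> h (\<rho> g x)" if "h \<in> carrier G" "g \<in> carrier G" for g h x
    using rep that by (auto simp: integral_representation_def lattice_Aut_def hom_def)
  note [simp] = representation_add[OF S(2)] representation_scale[OF S(2)] S(3)
  define R where "R = representation S"
  have R_add: "R (x + y) b = R x b + R y b" and R_scale: "R (s c x) b = c * R x b" for x y c b
    by (simp_all add: R_def)
  define B where "B x y = (\<Sum>g\<in>carrier G. \<Sum>b\<in>S. Re (cnj (R (\<rho> g x) b) * R (\<rho> g y) b))" for x y
  have add: "\<rho> g (x + y) = \<rho> g x + \<rho> g y" and scale: "\<rho> g (s c x) = s c (\<rho> g x)"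
    if "g \<in> carrier G" for g x y c
    using lin[OF that] by (simp_all add: Vector_Spaces.linear_iff)
  have "inner_product_on s UNIV B"
    unfolding inner_product_on_def
  proof (intro conjI ballI allI impI)
    fix u v w :: 'v and r :: real
    show "B (u + v) w = B u w + B v w"
      unfolding B_def sum.distrib[symmetric]
      by (intro sum.cong) (simp_all add: add R_add algebra_simps)
    show "B (rscale s r u) v = r * B u v"
      unfolding B_def sum_distrib_left
      by (intro sum.cong) (simp_all add: scale R_scale rscale_def algebra_simps)
    show "B u v = B v u"
      unfolding B_def by (intro sum.cong) (simp_all add: algebra_simps)
    assume u: "u \<noteq> 0"
    have nonneg: "(\<Sum>b\<in>S. Re (cnj (R x b) * R x b)) \<ge> 0" for x
      by (intro sum_nonneg) simp
    have pos: "(\<Sum>b\<in>S. Re (cnj (R (\<rho> \<one>\<^bsub>G\<^esub> u) b) * R (\<rho> \<one>\<^bsub>G\<^esub> u) b)) > 0"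
    proof -
      have "inj (\<rho> \<one>\<^bsub>G\<^esub>)"
        using rep by (auto simp: integral_representation_def lattice_Aut_def hom_def Pi_def bij_def)
      moreover have "\<rho> \<one>\<^bsub>G\<^esub> 0 = 0" using scale[of "\<one>\<^bsub>G\<^esub>" 0 0] by simp
      ultimately have "\<rho> \<one>\<^bsub>G\<^esub> u \<noteq> 0" using u by (metis injD)
      moreover have "(\<Sum>b\<in>S. s (R (\<rho> \<one>\<^bsub>G\<^esub> u) b) b) = \<rho> \<one>\<^bsub>G\<^esub> u"
        unfolding R_def by (rule sum_representation_eq) (use S in auto)
      moreover have "(\<Sum>b\<in>S. s (R (\<rho> \<one>\<^bsub>G\<^esub> u) b) b) = 0"
        if "\<forall>b\<in>S. R (\<rho> \<one>\<^bsub>G\<^esub> u) b = 0"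
        using that by (intro sum.neutral) simp
      ultimately have "\<not> (\<forall>b\<in>S. R (\<rho> \<one>\<^bsub>G\<^esub> u) b = 0)" by metis
      then obtain b where b: "b \<in> S" "R (\<rho> \<one>\<^bsub>G\<^esub> u) b \<noteq> 0" by blast
      have "Re (cnj c * c) > 0" if "c \<noteq> 0" for c :: complex
        using that by (simp add: complex_eq_iff sum_power2_gt_zero_iff flip: power2_eq_square)
      with b show ?thesis
        by (intro sum_pos2[OF S(1) b(1)]) auto
    qed
    show "B u u > 0"
      unfolding B_def using pos nonneg
      by (intro sum_pos2[OF fin one_closed, where
            f = "\<lambda>g. \<Sum>b\<in>S. Re (cnj (R (\<rho> g u) b) * R (\<rho> g u) b)"])
  qed
  moreover have "invariant_form G \<rho> UNIV B"
    unfolding invariant_form_def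
  proof (intro ballI)
    fix g u v assume g: "g \<in> carrier G"
    have bij: "bij_betw (\<lambda>h. h \<otimes>\<^bsub>G\<^esub> g) (carrier G) (carrier G)"
      by (rule bij_betwI[of _ _ _ "\<lambda>h. h \<otimes>\<^bsub>G\<^esub> inv\<^bsub>G\<^esub> g"]) (use g in \<open>auto simp: m_assoc\<close>)
    show "B (\<rho> g u) (\<rho> g v) = B u v"
      unfolding B_def
      by (subst sum.reindex_bij_betw[OF bij, symmetric]) (use g in \<open>auto simp: mult intro!: sum.cong\<close>)
  qed
  moreover have "integral_on L B"
    unfolding integral_on_def
  proof (intro ballI)
    have R_int: "R x b \<in> \<int>" if "x \<in> L" for x b
    proof -
      have "x \<in> z.span S" using that S(4) by simp
      then show ?thesis
      proof (induction rule: z.span_induct_alt)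
        case base
        show ?case by (simp add: R_def representation_zero)
      next
        case (step c x y)
        then show ?case
          by (simp add: R_add R_scale zscale_def) (simp add: R_def representation_basis[OF S(2)])
      qed
    qed
    fix x y assume "x \<in> L" "y \<in> L"
    show "B x y \<in> \<int>"
      unfolding B_def
    proof (intro Ints_sum)
      fix g b assume "g \<in> carrier G"
      then have "\<rho> g x \<in> L" "\<rho> g y \<in> L" using pres \<open>x \<in> L\<close> \<open>y \<in> L\<close> by auto
      then obtain i j where "R (\<rho> g x) b = of_int i" "R (\<rho> g y) b = of_int j"
        by (meson R_int Ints_cases)
      then show "Re (cnj (R (\<rho> g x) b) * R (\<rho> g y) b) \<in> \<int>" by simp
    qed
  qed
  ultimately show thesis using that by blast
qed

section \<open>Positive definite Hermitian spaces\<close>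

locale hermitian_space = vector_space s
  for s :: "complex \<Rightarrow> 'v::ab_group_add \<Rightarrow> 'v" +
  fixes H :: "'v \<Rightarrow> 'v \<Rightarrow> complex"
  assumes herm: "hermitian_form s H" and pos_def: "pos_def_form H"
begin

abbreviation E :: "'v \<Rightarrow> 'v \<Rightarrow> real" where "E x y \<equiv> Im (H x y)"

lemma H_add_right: "H x (y + z) = H x y + H x z"
  and H_scale_right: "H x (s c y) = c * H x y"
  and H_cnj: "H y x = cnj (H x y)"
  using herm unfolding hermitian_form_def by blast+

lemma H_add_left: "H (x + y) z = H x z + H y z"
  by (metis H_add_right H_cnj complex_cnj_add)

lemma H_scale_left: "H (s c x) y = cnj c * H x y"
  by (metis H_scale_right H_cnj complex_cnj_mult)

lemma H_diff_right: "H x (y - z) = H x y - H x z"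
  using H_add_right[of x "y - z" z] by simp

lemma H_zero: "H 0 x = 0" "H x 0 = 0"
  using H_scale_left[of 0 0] H_scale_right[of x 0 0] by simp_all

lemma E_antisym: "E y x = - E x y"
  by (subst H_cnj) simp

lemma E_rscale_right: "E x (rscale s r y) = r * E x y"
  and E_rscale_left: "E (rscale s r x) y = r * E x y"
  by (simp_all add: H_scale_right H_scale_left rscale_def)

lemma H_diag_real: "Im (H x x) = 0"
  using E_antisym[of x x] by simp

lemma H_diag_pos: "x \<noteq> 0 \<Longrightarrow> Re (H x x) > 0"
  using pos_def by (simp add: pos_def_form_def)

lemma E_zero_on_real_span_right:
  assumes "\<And>y. y \<in> A \<Longrightarrow> E x y = 0" "y \<in> real_span s A"
  shows "E x y = 0"
  by (rule real_functional_zero_on_real_span[OF vector_space_axioms, of "E x" A y])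
    (use assms in \<open>auto simp: H_add_right E_rscale_right\<close>)

lemma E_zero_on_real_span_left:
  assumes "\<And>x. x \<in> A \<Longrightarrow> E x y = 0" "x \<in> real_span s A"
  shows "E x y = 0"
  using E_zero_on_real_span_right[of A y x] assms E_antisym by (metis neg_equal_0_iff_equal)

text \<open>
  Positivity makes the imaginary part nondegenerate, as \<open>E (\<i> x) x = - H x x\<close>.
\<close>
lemma E_nondegenerate:
  assumes "real_span s A = UNIV" "\<And>y. y \<in> A \<Longrightarrow> E y x = 0"
  shows "x = 0"
proof (rule ccontr)
  assume "x \<noteq> 0"
  have "E (s \<i> x) x = 0"
    using E_zero_on_real_span_left[of A x "s \<i> x"] assms by auto
  then show False using H_diag_pos[OF \<open>x \<noteq> 0\<close>] by (simp add: H_scale_left)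
qed

end

section \<open>Splittings invariant under an absolutely irreducible group\<close>

text \<open>
  The situation after \<open>W\<close> has been identified with \<open>L \<otimes> \<complex>\<close>: the lattice splits as \<open>\<Lambda> = L \<oplus> M\<close> with
  both summands isotropic and invariant. On the real span of \<open>L\<close> any two choices of \<open>B\<close> differ by a
  positive factor, and replacing one by the other multiplies \<open>\<tau>\<close> by this factor.
\<close>
locale equivariant_splitting = hermitian_space s H + group G
  for s :: "complex \<Rightarrow> 'v::ab_group_add \<Rightarrow> 'v" and H and G :: "('g, 'b) monoid_scheme" (structure) +
  fixes n :: nat and L M \<Lambda> :: "'v set" and \<rho> :: "'g \<Rightarrow> 'v \<Rightarrow> 'v" and B :: "'v \<Rightarrow> 'v \<Rightarrow> real"
  assumes rep: "integral_representation G s n L \<rho>"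
    and irred: "absolutely_irreducible G s \<rho>"
    and full: "real_span s \<Lambda> = UNIV"
    and unimodular: "unimodular_on \<Lambda> E"
    and decomp: "decomposition s \<Lambda> H L M"
    and isometry: "\<And>g x y. g \<in> carrier G \<Longrightarrow> H (\<rho> g x) (\<rho> g y) = H x y"
    and M_invariant: "\<And>g x. g \<in> carrier G \<Longrightarrow> x \<in> M \<Longrightarrow> \<rho> g x \<in> M"
    and B_inner: "inner_product_on s UNIV B"
    and B_invariant: "invariant_form G \<rho> UNIV B"
    and B_integral: "integral_on L B"
begin

sublocale r: vector_space "rscale s"
  by (rule vector_space_rscale[OF vector_space_axioms])

sublocale z: module "zscale s"
  by (rule module_zscale[OF vector_space_axioms])

abbreviation U :: "'v set" where "U \<equiv> real_span s L"

lemma L_structure: "integral_structure s n L"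
  using rep by (simp add: integral_representation_def)

lemma \<rho>_linear: "g \<in> carrier G \<Longrightarrow> Vector_Spaces.linear s s (\<rho> g)"
  and \<rho>_image: "g \<in> carrier G \<Longrightarrow> \<rho> g ` L = L"
  using rep by (auto simp: integral_representation_def lattice_Aut_def hom_def Pi_def)

lemma subgroups: "z.subspace L" "z.subspace M"
  and \<Lambda>_eq: "\<Lambda> = {x + y |x y. x \<in> L \<and> y \<in> M}"
  and disjoint: "L \<inter> M = {0}"
  and isotropic: "\<And>x y. x \<in> L \<Longrightarrow> y \<in> L \<Longrightarrow> E x y = 0" "\<And>x y. x \<in> M \<Longrightarrow> y \<in> M \<Longrightarrow> E x y = 0"
  using decomp by (auto simp: decomposition_def isotropic_on_def)

lemmas zero_mem = subgroups[THEN z.subspace_0]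
lemmas add_mem = subgroups[THEN z.subspace_add]
lemmas diff_mem = subgroups[THEN z.subspace_diff]

lemma L_sub_\<Lambda>: "x \<in> L \<Longrightarrow> x \<in> \<Lambda>" and M_sub_\<Lambda>: "x \<in> M \<Longrightarrow> x \<in> \<Lambda>"
  using zero_mem by (force simp: \<Lambda>_eq)+

lemma L_sub_U: "x \<in> L \<Longrightarrow> x \<in> U"
  by (simp add: real_span_def r.span_base)

lemma U_add: "x \<in> U \<Longrightarrow> y \<in> U \<Longrightarrow> x + y \<in> U"
  and U_rscale: "x \<in> U \<Longrightarrow> rscale s a x \<in> U"
  and U_diff: "x \<in> U \<Longrightarrow> y \<in> U \<Longrightarrow> x - y \<in> U"
  and U_zero: "0 \<in> U"
  by (simp_all add: real_span_def r.span_add r.span_scale r.span_diff r.span_zero)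

lemma eq_by_pairing:
  assumes "\<And>y. y \<in> L \<Longrightarrow> E y x = E y x'" "\<And>y. y \<in> M \<Longrightarrow> E y x = E y x'"
  shows "x = x'"
proof -
  have "x - x' = 0"
    by (rule E_nondegenerate[OF full])
      (use assms in \<open>auto simp: \<Lambda>_eq H_add_left H_diff_right\<close>)
  then show ?thesis by simp
qed

text \<open>
  Unimodularity identifies \<open>M\<close> with the dual group of \<open>L\<close>: extend the functional by zero on \<open>M\<close> and
  represent it by some \<open>x \<in> \<Lambda>\<close>. The \<open>L\<close>-component of \<open>x\<close> pairs to zero with \<open>M\<close>, since \<open>x\<close> does and \<open>M\<close>
  is isotropic, and it pairs to zero with \<open>L\<close> because \<open>L\<close> is isotropic; so it vanishes.
\<close>
lemma integral_functional_on_L: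
  assumes add: "\<And>x y. x \<in> L \<Longrightarrow> y \<in> L \<Longrightarrow> f (x + y) = f x + f y"
    and int: "\<And>x. x \<in> L \<Longrightarrow> f x \<in> \<int>"
  obtains x where "x \<in> M" "\<And>y. y \<in> L \<Longrightarrow> E y x = f y"
proof -
  have "\<exists>l. \<forall>y\<in>\<Lambda>. l y \<in> L \<and> y - l y \<in> M"
    by (rule bchoice) (force simp: \<Lambda>_eq)
  then obtain l where l: "\<And>y. y \<in> \<Lambda> \<Longrightarrow> l y \<in> L" "\<And>y. y \<in> \<Lambda> \<Longrightarrow> y - l y \<in> M" by blast
  have l_eq: "l (x + y) = x" if "x \<in> L" "y \<in> M" for x y
  proof -
    have xy: "x + y \<in> \<Lambda>" using that \<Lambda>_eq by blast
    have "l (x + y) - x \<in> L" using diff_mem(1) l(1)[OF xy] that by blast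
    moreover have "y - ((x + y) - l (x + y)) \<in> M" using diff_mem(2) l(2)[OF xy] that by blast
    ultimately have "l (x + y) - x \<in> L \<inter> M" by (simp add: algebra_simps)
    then show ?thesis using disjoint by simp
  qed
  (* unimodularity concerns integer valued functions, hence the floor; the sign is there because the
     representing vector is wanted in the second argument of E *)
  define h where "h y = - \<lfloor>f (l y)\<rfloor>" for y
  have h: "real_of_int (h (x + y)) = - f x" if "x \<in> L" "y \<in> M" for x y
    using int[OF that(1)] by (auto simp: h_def l_eq[OF that] elim!: Ints_cases)
  have "h (y + y') = h y + h y'" if yy': "y \<in> \<Lambda>" "y' \<in> \<Lambda>" for y y'
  proof -
    obtain a b a' b' where ab: "y = a + b" "y' = a' + b'" "a \<in> L" "b \<in> M" "a' \<in> L" "b' \<in> M"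
      using \<Lambda>_eq yy' by blast
    have sum: "y + y' = (a + a') + (b + b')" using ab by (simp add: algebra_simps)
    have "real_of_int (h (y + y')) = - f (a + a')"
      unfolding sum by (rule h) (use ab add_mem in auto)
    also have "\<dots> = real_of_int (h y + h y')" using ab by (simp add: h add)
    finally show ?thesis by linarith
  qed
  then have "\<exists>!x. x \<in> \<Lambda> \<and> (\<forall>y\<in>\<Lambda>. E x y = real_of_int (h y))"
    using unimodular[unfolded unimodular_on_def, THEN conjunct2, rule_format, of h] by simp
  then obtain x where x: "x \<in> \<Lambda>" "\<And>y. y \<in> \<Lambda> \<Longrightarrow> E x y = real_of_int (h y)"
    by blast
  have xL: "E x y = - f y" if "y \<in> L" for y
    using x(2)[OF L_sub_\<Lambda>] h[of y 0] zero_mem that by simp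
  have xM: "E x y = 0" if "y \<in> M" for y
  proof -
    have "f 0 = 0" using add[of 0 0] zero_mem by simp
    then show ?thesis using x(2)[OF M_sub_\<Lambda>] h[of 0 y] zero_mem that by simp
  qed
  obtain a b where ab: "x = a + b" "a \<in> L" "b \<in> M" using x(1) \<Lambda>_eq by blast
  have "a = 0"
  proof (rule eq_by_pairing)
    fix y assume "y \<in> L" then show "E y a = E y 0" using isotropic(1) ab by (simp add: H_zero)
  next
    fix y assume y: "y \<in> M"
    have "E a y = E x y" using isotropic(2) ab y by (simp add: H_add_left)
    then show "E y a = E y 0" using xM[OF y] E_antisym[of y a] by (simp add: H_zero)
  qed
  with ab have "x \<in> M" by simp
  moreover have "E y x = f y" if "y \<in> L" for y
    using xL[OF that] E_antisym[of y x] by simp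
  ultimately show thesis by (rule that)
qed

lemma B_add_left: "B (x + y) z = B x z + B y z"
  using B_inner[unfolded inner_product_on_def, THEN conjunct1] by simp

lemma B_rscale_left: "B (rscale s a x) z = a * B x z"
  using B_inner[unfolded inner_product_on_def, THEN conjunct2, THEN conjunct1] by simp

lemma B_sym: "B x y = B y x"
  using B_inner[unfolded inner_product_on_def, THEN conjunct2, THEN conjunct2, THEN conjunct1]
  by (elim ballE[of _ _ x] ballE[of _ _ y]) simp_all

lemma B_pos: "x \<noteq> 0 \<Longrightarrow> B x x > 0"
  using B_inner[unfolded inner_product_on_def, THEN conjunct2, THEN conjunct2, THEN conjunct2] by simp

lemma B_add_right: "B z (x + y) = B z x + B z y"
  by (simp only: B_sym[of z] B_add_left)

lemma B_diff_right: "B z (x - y) = B z x - B z y"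
  using B_add_right[of z "x - y" y] by simp

lemma B_rscale_right: "B z (rscale s a x) = a * B z x"
  by (simp only: B_sym[of z] B_rscale_left)

text \<open>
  Each \<open>l \<in> L\<close> gives the integral functional \<open>B \<cdot> l\<close> on \<open>L\<close>, which is represented by a unique
  \<open>\<phi> l \<in> M\<close>. As \<open>B\<close>, \<open>E\<close> and the splitting are invariant, \<open>\<phi> : L \<rightarrow> M\<close> is equivariant, so its complex
  linear extension commutes with the group and is multiplication by a scalar \<open>\<tau>\<close>.
\<close>
lemma scalar_realising_B:
  obtains \<tau> where "\<And>x. x \<in> L \<Longrightarrow> s \<tau> x \<in> M" "\<And>x y. x \<in> L \<Longrightarrow> y \<in> L \<Longrightarrow> E y (s \<tau> x) = B y x"
proof -
  have "\<exists>x\<in>M. \<forall>y\<in>L. E y x = B y l" if "l \<in> L" for l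
  proof (rule integral_functional_on_L[of "\<lambda>y. B y l"])
    show "B (x + y) l = B x l + B y l" for x y by (rule B_add_left)
    show "B x l \<in> \<int>" if "x \<in> L" for x
      using B_integral that \<open>l \<in> L\<close> by (simp add: integral_on_def)
  qed blast
  then have "\<exists>\<phi>. \<forall>l\<in>L. \<phi> l \<in> M \<and> (\<forall>y\<in>L. E y (\<phi> l) = B y l)"
    by (intro bchoice) blast
  then obtain \<phi> where \<phi>: "\<And>l. l \<in> L \<Longrightarrow> \<phi> l \<in> M" "\<And>l y. l \<in> L \<Longrightarrow> y \<in> L \<Longrightarrow> E y (\<phi> l) = B y l"
    by blast
  have \<phi>_add: "\<phi> (x + y) = \<phi> x + \<phi> y" if "x \<in> L" "y \<in> L" for x y
    by (rule eq_by_pairing)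
      (use that in \<open>simp_all add: \<phi> add_mem H_add_right B_add_right isotropic(2)\<close>)
  obtain T where T: "Vector_Spaces.linear s s T" "\<And>x. x \<in> L \<Longrightarrow> T x = \<phi> x"
    by (rule extend_additive_to_linear[OF L_structure vector_space_axioms \<phi>_add]) blast+
  have comm: "T (\<rho> g x) = \<rho> g (T x)" if g: "g \<in> carrier G" for g x
  proof -
    have "\<phi> (\<rho> g l) = \<rho> g (\<phi> l)" if l: "l \<in> L" for l
    proof (rule eq_by_pairing)
      have gl: "\<rho> g l \<in> L" using \<rho>_image[OF g] l by blast
      fix y assume "y \<in> L"
      then obtain y' where y': "y' \<in> L" "y = \<rho> g y'" using \<rho>_image[OF g] by blast
      have "E y (\<phi> (\<rho> g l)) = B (\<rho> g y') (\<rho> g l)"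
        using \<phi>(2)[OF gl \<open>y \<in> L\<close>] y' by simp
      also have "\<dots> = B y' l" using B_invariant g by (simp add: invariant_form_def)
      also have "\<dots> = E y (\<rho> g (\<phi> l))"
        using \<phi>(2)[OF l y'(1)] isometry[OF g] y' by simp
      finally show "E y (\<phi> (\<rho> g l)) = E y (\<rho> g (\<phi> l))" .
    next
      have gl: "\<rho> g l \<in> L" using \<rho>_image[OF g] l by blast
      fix y assume "y \<in> M"
      then show "E y (\<phi> (\<rho> g l)) = E y (\<rho> g (\<phi> l))"
        by (simp add: isotropic(2) \<phi>(1) gl l M_invariant[OF g])
    qed
    moreover have "\<rho> g l \<in> L" if "l \<in> L" for l using \<rho>_image[OF g] that by blast
    ultimately have on_L: "(T \<circ> \<rho> g) l = (\<rho> g \<circ> T) l" if "l \<in> L" for l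
      using that by (simp add: T(2))
    have "(T \<circ> \<rho> g) x = (\<rho> g \<circ> T) x"
      by (rule linear_eq_on_integral_structure[OF L_structure _ _ on_L])
        (rule Vector_Spaces.linear_compose T(1) \<rho>_linear[OF g])+
    then show ?thesis by simp
  qed
  obtain S where "finite S" "span S = UNIV"
    using L_structure by (auto simp: integral_structure_def)
  then obtain \<tau> where \<tau>: "\<And>x. T x = s \<tau> x"
    by (rule schur_scalar[OF T(1) _ _ irred \<rho>_linear comm]) blast+
  show thesis
    by (rule that[of \<tau>]) (use \<phi> T(2) in \<open>simp_all flip: \<tau>\<close>)
qed

lemma E_isotropic_U: assumes "u \<in> U" "v \<in> U" shows "E u v = 0"
proof (rule E_zero_on_real_span_left[OF _ assms(1)])
  fix x assume "x \<in> L"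
  then show "E x v = 0"
    using E_zero_on_real_span_right[OF _ assms(2)] isotropic(1) by blast
qed

lemma pairing_on_real_span:
  assumes \<tau>: "\<And>x y. x \<in> L \<Longrightarrow> y \<in> L \<Longrightarrow> E y (s \<tau> x) = B y x"
    and u: "u \<in> U" and v: "v \<in> U"
  shows "E v (s \<tau> u) = B v u"
proof -
  note vanish = real_functional_zero_on_real_span[OF vector_space_axioms]
  have st: "s \<tau> (rscale s a x) = rscale s a (s \<tau> x)" for a x
    by (simp add: rscale_def mult.commute)
  have 1: "E v (s \<tau> x) - B v x = 0" if x: "x \<in> L" for x
    by (rule vanish[of "\<lambda>v. E v (s \<tau> x) - B v x", OF _ _ _ v])
      (use \<tau>[OF x] in \<open>simp_all add: H_add_left E_rscale_left B_add_left B_rscale_left algebra_simps\<close>)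
  have "E v (s \<tau> u) - B v u = 0"
    by (rule vanish[of "\<lambda>u. E v (s \<tau> u) - B v u", OF _ _ _ u])
      (use 1 in \<open>simp_all add: scale_right_distrib st H_add_right E_rscale_right B_add_right
         B_rscale_right algebra_simps\<close>)
  then show ?thesis by simp
qed

text \<open>
  With \<open>E u (\<tau> v) = B u v\<close> on \<open>U\<close>, positivity of \<open>H\<close> gives \<open>Im \<tau> > 0\<close>, so \<open>V = U \<oplus> \<tau> U\<close>. An element of
  \<open>M\<close> has no \<open>U\<close>-component because it pairs to zero with \<open>\<tau> L \<subseteq> M\<close>, and its \<open>\<tau> U\<close>-component is in the
  dual lattice because \<open>E\<close> is integral. Conversely a dual lattice vector \<open>u\<close> gives an integral
  functional on \<open>L\<close>, represented both by \<open>\<tau> u\<close> and by an element \<open>\<tau> u'\<close> of \<open>M\<close>, and these agree because \<open>B\<close> is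
  definite. Hence \<open>M = \<tau> L\<^sup>*\<close>.
\<close>
lemma splitting_eq_X:
  obtains \<tau> where "Im \<tau> > 0" "X_form s L B \<tau> H" "X_lattice s L B \<tau> = \<Lambda>"
proof -
  obtain \<tau> where \<tau>M: "\<And>x. x \<in> L \<Longrightarrow> s \<tau> x \<in> M"
    and \<tau>L: "\<And>x y. x \<in> L \<Longrightarrow> y \<in> L \<Longrightarrow> E y (s \<tau> x) = B y x"
    using scalar_realising_B by blast
  have E\<tau>: "E v (s \<tau> u) = B v u" if "u \<in> U" "v \<in> U" for u v
    by (rule pairing_on_real_span[OF _ that]) (rule \<tau>L)
  have U0: "u = 0" if u: "u \<in> U" and l: "\<And>l. l \<in> L \<Longrightarrow> B l u = 0" for u
  proof -
    have "B u u = 0"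
      by (rule real_functional_zero_on_real_span[OF vector_space_axioms, of "\<lambda>v. B v u", OF _ _ _ u])
        (use l in \<open>auto simp: B_add_left B_rscale_left\<close>)
    then show ?thesis using B_pos[of u] by (cases "u = 0") auto
  qed
  obtain S where S: "span S = UNIV" "L = z.span S"
    using L_structure by (auto simp: integral_structure_def)
  have \<tau>pos: "Im \<tau> > 0"
  proof -
    obtain u where u: "u \<in> L" "u \<noteq> 0"
    proof -
      have "(UNIV :: 'v set) \<noteq> {0}" using irred by (simp add: absolutely_irreducible_def)
      then have "\<not> span S \<subseteq> {0}" unfolding S(1) by blast
      then obtain b where "b \<in> S" "b \<noteq> 0"
        using span_minimal[of S "{0}"] by auto
      then show thesis using that S(2) z.span_base by blast
    qed
    have "Im \<tau> * Re (H u u) = E u (s \<tau> u)"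
      by (simp add: H_scale_right H_diag_real)
    also have "\<dots> > 0" using \<tau>L u B_pos by simp
    finally show ?thesis using H_diag_pos[OF u(2)] by (simp add: zero_less_mult_iff)
  qed
  have E\<tau>\<tau>: "E (s \<tau> u) (s \<tau> v) = 0" if "u \<in> U" "v \<in> U" for u v
  proof -
    have "H (s \<tau> u) (s \<tau> v) = (cnj \<tau> * \<tau>) * H u v"
      by (simp add: H_scale_left H_scale_right)
    then show ?thesis using E_isotropic_U that by simp
  qed
  have "X_form s L B \<tau> H"
    unfolding X_form_def
  proof (intro conjI ballI)
    show "hermitian_form s H" by (rule herm)
    fix u u' v v' assume uv: "u \<in> U" "u' \<in> U" "v \<in> U" "v' \<in> U"
    have "E (s \<tau> u') v = - B v u'" using E_antisym[of v "s \<tau> u'"] E\<tau> uv by simp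
    then show "E (u + s \<tau> u') (v + s \<tau> v') = B u v' - B v u'"
      using uv by (simp add: H_add_left H_add_right E\<tau> E\<tau>\<tau> E_isotropic_U)
  qed
  moreover have "X_lattice s L B \<tau> = \<Lambda>"
  proof -
    have coords: "\<exists>u\<in>U. \<exists>u'\<in>U. x = u + s \<tau> u'" for x
    proof -
      have "x \<in> span S" using S by simp
      then show ?thesis
      proof (induction rule: span_induct_alt)
        case base
        show ?case using U_zero by (intro bexI[of _ 0]) auto
      next
        case (step c b y)
        then obtain u u' where u: "u \<in> U" "u' \<in> U" "y = u + s \<tau> u'" by blast
        have b: "b \<in> U" using step S(2) z.span_base L_sub_U by blast
        (* the real coordinates of c in the basis 1, \<tau> of the complex numbers *)
        define d where "d = Im c / Im \<tau>"
        define a where "a = Re c - d * Re \<tau>"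
        have "c = of_real a + \<tau> * of_real d"
          using \<tau>pos by (simp add: complex_eq_iff a_def d_def)
        then have "s c b + y = (rscale s a b + u) + s \<tau> (rscale s d b + u')"
          using u by (simp add: rscale_def scale_left_distrib scale_right_distrib add_ac)
        then show ?case using b u U_add U_rscale by blast
      qed
    qed
    have M_eq: "\<exists>u'\<in>dual_lattice s B L. y = s \<tau> u'" if y: "y \<in> M" for y
    proof -
      obtain u u' where u: "u \<in> U" "u' \<in> U" "y = u + s \<tau> u'" using coords by blast
      have "B l u = 0" if l: "l \<in> L" for l
      proof -
        have "0 = E y (s \<tau> l)" using isotropic(2) y \<tau>M[OF l] by simp
        also have "\<dots> = B l u"
          using u l L_sub_U[OF l] by (simp add: H_add_left E\<tau> E\<tau>\<tau> B_sym[of u l])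
        finally show ?thesis by simp
      qed
      then have y_eq: "y = s \<tau> u'" using U0 u by simp
      have "B u' l \<in> \<int>" if l: "l \<in> L" for l
      proof -
        have "B u' l = E l y" using E\<tau>[OF u(2) L_sub_U[OF l]] y_eq B_sym[of u' l] by simp
        then show ?thesis
          using unimodular L_sub_\<Lambda>[OF l] M_sub_\<Lambda>[OF y]
          by (auto simp: unimodular_on_def integral_on_def)
      qed
      with u y_eq show ?thesis by (auto simp: dual_lattice_def)
    qed
    have dual_in_M: "s \<tau> u \<in> M" if "u \<in> dual_lattice s B L" for u
    proof -
      have u: "u \<in> U" using that by (simp add: dual_lattice_def)
      have int: "B l u \<in> \<int>" if "l \<in> L" for l
        using \<open>u \<in> dual_lattice s B L\<close> that B_sym[of l u] by (simp add: dual_lattice_def)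
      obtain x where x: "x \<in> M" "\<And>y. y \<in> L \<Longrightarrow> E y x = B y u"
        by (rule integral_functional_on_L[of "\<lambda>y. B y u", OF B_add_left int]) blast+
      obtain u' where u': "u' \<in> U" "x = s \<tau> u'"
        using M_eq[OF x(1)] unfolding dual_lattice_def by blast
      have "B l (u' - u) = 0" if "l \<in> L" for l
        using x(2)[OF that] E\<tau>[OF u'(1) L_sub_U[OF that]] u'(2) by (simp add: B_diff_right)
      then have "u' - u = 0"
        using u u'(1) by (intro U0) (simp_all add: U_diff)
      then have "u' = u" by simp
      with x u' show ?thesis by simp
    qed
    show ?thesis
      unfolding X_lattice_def \<Lambda>_eq using M_eq dual_in_M by blast
  qed
  ultimately show thesis using \<tau>pos by (intro that)
qed

end

section \<open>Transport along linear isomorphisms\<close>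

lemma linear_restrict_scalars:
  assumes "Vector_Spaces.linear s s' F"
  shows "module_hom (rscale s) (rscale s') F" "module_hom (zscale s) (zscale s') F"
  using assms unfolding Vector_Spaces.linear_iff
  by (auto simp: module_hom_iff vector_space_rscale module_iff_vector_space module_zscale)
    (auto simp: rscale_def zscale_def)

lemma lattice_of_rank_image:
  assumes K: "Vector_Spaces.linear s s' K" "bij K" and L: "lattice_of_rank s k \<Lambda>"
  shows "lattice_of_rank s' k (K ` \<Lambda>)"
proof -
  interpret r: module_hom "rscale s" "rscale s'" K by (rule linear_restrict_scalars[OF K(1)])
  interpret z: module_hom "zscale s" "zscale s'" K by (rule linear_restrict_scalars[OF K(1)])
  obtain S where S: "finite S" "card S = k" "\<not> r.m1.dependent S"
    "r.m1.span S = UNIV" "\<Lambda> = z.m1.span S"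
    using L unfolding lattice_of_rank_def by blast
  have inj: "inj_on K A" for A using K(2) by (meson bij_def inj_on_subset subset_UNIV)
  show ?thesis
    unfolding lattice_of_rank_def
  proof (intro exI[of _ "K ` S"] conjI)
    show "\<not> r.m2.dependent (K ` S)"
      using r.independent_injective_image[OF S(3) inj] .
    show "r.m2.span (K ` S) = UNIV"
      using K(2) by (simp add: r.span_image S(4) bij_is_surj)
  qed (use S in \<open>simp_all add: card_image inj z.span_image\<close>)
qed

lemma lattice_of_rank_real_span:
  assumes "vector_space s" "lattice_of_rank s k \<Lambda>"
  shows "real_span s \<Lambda> = UNIV"
proof -
  interpret r: vector_space "rscale s" using assms(1) by (rule vector_space_rscale)
  interpret z: module "zscale s" using assms(1) by (rule module_zscale)
  obtain S where S: "r.span S = UNIV" "\<Lambda> = z.span S"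
    using assms(2) unfolding lattice_of_rank_def by blast
  then have "r.span S \<subseteq> r.span \<Lambda>" using z.span_superset by (intro r.span_mono) blast
  with S(1) show ?thesis unfolding real_span_def by blast
qed

lemma ppav_real_span: "ppav s m \<Lambda> H \<Longrightarrow> real_span s \<Lambda> = UNIV"
  unfolding ppav_def using lattice_of_rank_real_span by blast

lemma dim_bijective_image:
  assumes K: "Vector_Spaces.linear s s' K" "bij K"
  shows "vector_space.dim s' UNIV = vector_space.dim s UNIV"
proof -
  interpret K: Vector_Spaces.linear s s' K by fact
  obtain S where S: "K.vs1.independent S" "K.vs1.span S = UNIV"
    using K.vs1.basis_exists[of UNIV] by (metis top.extremum_uniqueI)
  have inj: "inj_on K A" for A using K(2) by (meson bij_def inj_on_subset subset_UNIV)
  have "K.vs2.dim UNIV = card (K ` S)"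
    by (rule K.vs2.dim_eq_card)
      (use K.independent_injective_image[OF S(1) inj] K(2) in \<open>simp_all add: K.span_image S(2) bij_is_surj\<close>)
  also have "\<dots> = K.vs1.dim UNIV"
    using K.vs1.dim_eq_card[of S UNIV] S by (simp add: card_image inj)
  finally show ?thesis .
qed

text \<open>
  Through this \<open>X(B,\<tau>)\<close> inherits the property of being a principally polarized abelian variety from
  the decomposable one, whose form and lattice are transported to \<open>L \<otimes> \<complex>\<close>.
\<close>
lemma ppav_iso_map_ppav:
  assumes iso: "ppav_iso_map s \<Lambda> H s' \<Lambda>' H' K" and X: "ppav s m \<Lambda> H"
  shows "ppav s' m \<Lambda>' H'"
proof -
  have K: "Vector_Spaces.linear s s' K" "bij K" and im: "K ` \<Lambda> = \<Lambda>'"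
    and H': "\<And>x y. H' (K x) (K y) = H x y"
    using iso by (auto simp: ppav_iso_map_def)
  interpret K: Vector_Spaces.linear s s' K by fact
  have surj: "\<exists>x. y = K x" for y using K(2) by (metis bij_pointE)
  have "hermitian_form s' H'"
    unfolding hermitian_form_def
  proof (intro conjI allI)
    have herm: "H x (y + z) = H x y + H x z" "H x (s c y) = c * H x y" "H y x = cnj (H x y)" for x y z c
      using X unfolding ppav_def hermitian_form_def by blast+
    fix x' y' z' c
    obtain x y z where xyz: "x' = K x" "y' = K y" "z' = K z" using surj by metis
    show "H' x' (y' + z') = H' x' y' + H' x' z'" by (simp add: xyz H' herm(1) flip: K.add)
    show "H' x' (s' c y') = c * H' x' y'" by (simp add: xyz H' herm(2) flip: K.scale)
    show "H' y' x' = cnj (H' x' y')" unfolding xyz H' by (rule herm(3))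
  qed
  moreover have "pos_def_form H'"
    unfolding pos_def_form_def
  proof (intro allI impI)
    fix x' :: 'b assume "x' \<noteq> 0"
    moreover obtain x where "x' = K x" using surj by blast
    moreover from calculation have "x \<noteq> 0" by auto
    ultimately show "Re (H' x' x') > 0"
      using X by (simp add: ppav_def pos_def_form_def H')
  qed
  moreover have "unimodular_on \<Lambda>' (\<lambda>x y. Im (H' x y))"
    unfolding unimodular_on_def
  proof (intro conjI allI impI)
    have uni: "unimodular_on \<Lambda> (\<lambda>x y. Im (H x y))" using X by (simp add: ppav_def)
    then show "integral_on \<Lambda>' (\<lambda>x y. Im (H' x y))"
      by (auto simp: unimodular_on_def integral_on_def H' simp flip: im)
    fix f :: "'b \<Rightarrow> int" assume f: "\<forall>y\<in>\<Lambda>'. \<forall>z\<in>\<Lambda>'. f (y + z) = f y + f z"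
    have "\<forall>y\<in>\<Lambda>. \<forall>z\<in>\<Lambda>. (f \<circ> K) (y + z) = (f \<circ> K) y + (f \<circ> K) z"
      using f by (auto simp: K.add simp flip: im)
    then have "\<exists>!x. x \<in> \<Lambda> \<and> (\<forall>y\<in>\<Lambda>. Im (H x y) = real_of_int ((f \<circ> K) y))"
      using uni[unfolded unimodular_on_def, THEN conjunct2, THEN spec, of "f \<circ> K"] by blast
    then obtain x where x: "x \<in> \<Lambda>" "\<And>y. y \<in> \<Lambda> \<Longrightarrow> Im (H x y) = real_of_int (f (K y))"
      and uniq: "\<And>x'. x' \<in> \<Lambda> \<Longrightarrow> (\<And>y. y \<in> \<Lambda> \<Longrightarrow> Im (H x' y) = real_of_int (f (K y))) \<Longrightarrow> x' = x"
      unfolding comp_apply by blast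
    show "\<exists>!x. x \<in> \<Lambda>' \<and> (\<forall>y\<in>\<Lambda>'. Im (H' x y) = real_of_int (f y))"
    proof (rule ex1I[of _ "K x"])
      show "K x \<in> \<Lambda>' \<and> (\<forall>y\<in>\<Lambda>'. Im (H' (K x) y) = real_of_int (f y))"
        using x by (auto simp: H' simp flip: im)
      fix x' assume x': "x' \<in> \<Lambda>' \<and> (\<forall>y\<in>\<Lambda>'. Im (H' x' y) = real_of_int (f y))"
      then obtain x'' where "x'' \<in> \<Lambda>" "x' = K x''" using im by blast
      moreover from this x' have "x'' = x"
        by (intro uniq) (auto simp: H' simp flip: im)
      ultimately show "x' = K x" by simp
    qed
  qed
  ultimately show ?thesis
    using X lattice_of_rank_image[OF K, of "2 * m" \<Lambda>] dim_bijective_image[OF K] K.vs2.vector_space_axioms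
    by (simp add: ppav_def im)
qed

section \<open>The ambient space as the complexification of an isotropic summand\<close>

text \<open>
  The real span of an isotropic summand is its own orthogonal with respect to \<open>E\<close>. Write \<open>w = w1 + w2\<close>
  according to the real spans of \<open>L1\<close> and \<open>L2\<close>; if \<open>w\<close> is orthogonal to \<open>L1\<close>, then \<open>w2\<close> pairs to zero
  with both summands, so \<open>w\<close> is in the real span of \<open>L1\<close> and is orthogonal to itself.
\<close>
lemma (in hermitian_space) zero_if_orthogonal_to_isotropic_summand:
  assumes decomp: "decomposition s \<Lambda> H L1 L2" and full: "real_span s \<Lambda> = UNIV"
    and orth: "\<And>x. x \<in> L1 \<Longrightarrow> H x w = 0"
  shows "w = 0"
proof -
  interpret r: vector_space "rscale s" by (rule vector_space_rscale[OF vector_space_axioms])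
  have \<Lambda>: "\<Lambda> = {x + y |x y. x \<in> L1 \<and> y \<in> L2}"
    and iso: "\<And>x y. x \<in> L1 \<Longrightarrow> y \<in> L1 \<Longrightarrow> E x y = 0" "\<And>x y. x \<in> L2 \<Longrightarrow> y \<in> L2 \<Longrightarrow> E x y = 0"
    using decomp by (auto simp: decomposition_def isotropic_on_def)
  have "r.subspace {x + y |x y. x \<in> r.span L1 \<and> y \<in> r.span L2}"
    by (intro r.subspace_sums r.subspace_span)
  then have "r.span \<Lambda> \<subseteq> {x + y |x y. x \<in> r.span L1 \<and> y \<in> r.span L2}"
    unfolding \<Lambda> by (intro r.span_minimal) (use r.span_base in blast)
  then obtain w1 w2 where w: "w = w1 + w2" "w1 \<in> real_span s L1" "w2 \<in> real_span s L2"
    using full unfolding real_span_def by blast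
  have "w2 = 0"
  proof (rule E_nondegenerate[OF full])
    fix y assume "y \<in> \<Lambda>"
    then obtain a b where ab: "y = a + b" "a \<in> L1" "b \<in> L2" unfolding \<Lambda> by blast
    have "E a w1 = 0" by (rule E_zero_on_real_span_right[OF _ w(2)]) (use iso ab in auto)
    moreover have "E b w2 = 0" by (rule E_zero_on_real_span_right[OF _ w(3)]) (use iso ab in auto)
    moreover have "E a w = 0" using orth[OF ab(2)] by simp
    ultimately show "E y w2 = 0" by (simp add: ab(1) w(1) H_add_left H_add_right)
  qed
  then have "w \<in> r.span L1" using w by (simp add: real_span_def)
  moreover have "r.subspace {x. H x w = 0}"
    by (auto simp: r.subspace_def H_add_left H_scale_left H_zero rscale_def)
  then have "r.span L1 \<subseteq> {x. H x w = 0}"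
    by (intro r.span_minimal) (use orth in auto)
  ultimately have "H w w = 0" by blast
  then show ?thesis using H_diag_pos[of w] by (cases "w = 0") auto
qed

lemma linear_inverse_of_bij:
  assumes F: "Vector_Spaces.linear s s' F" "bij F"
  shows "Vector_Spaces.linear s' s (inv_into UNIV F)"
proof -
  interpret F: Vector_Spaces.linear s s' F by fact
  have "inv_into UNIV F (x + y) = inv_into UNIV F x + inv_into UNIV F y" for x y
    using F(2) by (metis F.add bij_inv_eq_iff)
  moreover have "inv_into UNIV F (s' c x) = s c (inv_into UNIV F x)" for c x
    using F(2) by (metis F.scale bij_inv_eq_iff)
  ultimately show ?thesis
    using F.vs1.vector_space_axioms F.vs2.vector_space_axioms by (simp add: Vector_Spaces.linear_iff)
qed

text \<open>
  Surjectivity is obtained from \<open>\<psi> : W \<rightarrow> V\<close>, which takes the coordinates \<open>H (F b) w\<close>. It is injective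
  by the previous lemma, and \<open>\<psi> \<circ> F\<close> is an injective endomorphism of the finite dimensional space
  \<open>V\<close>, so it is onto.
\<close>
lemma bij_of_inj_covering_isotropic_summand:
  fixes sV :: "complex \<Rightarrow> 'v::ab_group_add \<Rightarrow> 'v" and sW :: "complex \<Rightarrow> 'w::ab_group_add \<Rightarrow> 'w"
  assumes "hermitian_space sW H"
    and decomp: "decomposition sW \<Lambda> H L1 L2" and full: "real_span sW \<Lambda> = UNIV"
    and L: "integral_structure sV n L"
    and F: "Vector_Spaces.linear sV sW F" "inj F" "L1 \<subseteq> range F"
  shows "bij F"
proof -
  interpret hermitian_space sW H by fact
  interpret F: Vector_Spaces.linear sV sW F by fact
  obtain S where S: "finite S" "\<not> F.vs1.dependent S" "F.vs1.span S = UNIV"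
    using L by (auto simp: integral_structure_def)
  interpret fin: finite_dimensional_vector_space sV S
    by unfold_locales (use S in auto)
  define \<psi> where "\<psi> w = (\<Sum>b\<in>S. sV (H (F b) w) b)" for w
  have \<psi>_linear: "Vector_Spaces.linear sW sV \<psi>"
    using F.vs1.vector_space_axioms vector_space_axioms
    by (simp add: Vector_Spaces.linear_iff \<psi>_def H_add_right H_scale_right
        F.vs1.scale_left_distrib sum.distrib F.vs1.scale_sum_right)
  interpret \<psi>: Vector_Spaces.linear sW sV \<psi> by (rule \<psi>_linear)
  have "w = 0" if "\<psi> w = 0" for w
  proof (rule zero_if_orthogonal_to_isotropic_summand[OF decomp full])
    have "H (F b) w = 0" if "b \<in> S" for b
      using F.vs1.independentD[OF S(2) S(1) order_refl \<open>\<psi> w = 0\<close>[unfolded \<psi>_def] that] .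
    then have "S \<subseteq> {x. H (F x) w = 0}" by blast
    moreover have "F.vs1.subspace {x. H (F x) w = 0}"
      by (auto simp: F.vs1.subspace_def F.add F.scale H_add_left H_scale_left H_zero)
    ultimately have "F.vs1.span S \<subseteq> {x. H (F x) w = 0}" by (rule F.vs1.span_minimal)
    then show "H x w = 0" if "x \<in> L1" for x
      using that F(3) S(3) by blast
  qed
  then have \<psi>_inj: "inj \<psi>" by (simp add: \<psi>.inj_iff_eq_0)
  have "surj (\<psi> \<circ> F)"
    by (rule fin.linear_inj_imp_surj)
      (use Vector_Spaces.linear_compose[OF F(1) \<psi>_linear] inj_compose[OF \<psi>_inj F(2)] in auto)
  then have "surj F"
    using \<psi>_inj by (metis comp_apply injD surjD surjI)
  then show ?thesis using F(2) by (simp add: bij_def)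
qed

section \<open>Decomposable principally polarized abelian varieties\<close>

theorem theorem2p5:
  fixes G :: "('g, 'b) monoid_scheme"
    and sV :: "complex \<Rightarrow> 'v::ab_group_add \<Rightarrow> 'v"
    and L :: "'v set" and n :: nat
    and \<rho> :: "'g \<Rightarrow> 'v \<Rightarrow> 'v"
    and sW :: "complex \<Rightarrow> 'w::ab_group_add \<Rightarrow> 'w"
    and \<Lambda> :: "'w set" and m :: nat
    and H :: "'w \<Rightarrow> 'w \<Rightarrow> complex"
  assumes "group G" and "finite (carrier G)"
    and "integral_representation G sV n L \<rho>"
    and "faithful_rep G \<rho>"
    and "absolutely_irreducible G sV \<rho>"
    and "ppav sW m \<Lambda> H"
    and "rho_decomposable G L \<rho> sW \<Lambda> H"
  shows "\<exists>B \<tau> H'.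
           inner_product_on sV (real_span sV L) B \<and>
           invariant_form G \<rho> (real_span sV L) B \<and>
           integral_on L B \<and>
           Im \<tau> > 0 \<and>
           X_form sV L B \<tau> H' \<and>
           ppav sV n (X_lattice sV L B \<tau>) H' \<and>
           ppav_isomorphic sW \<Lambda> H sV (X_lattice sV L B \<tau>) H'"
proof -
  interpret G: group G by fact
  obtain \<alpha> L1 L2 where act: "ppav_action G sW \<Lambda> H \<alpha>"
    and rdec: "rho_decomposition G L \<rho> sW \<Lambda> H \<alpha> L1 L2"
    using assms(7) unfolding rho_decomposable_def by blast
  have dec: "decomposition sW \<Lambda> H L1 L2"
    and inv2: "\<And>g x. g \<in> carrier G \<Longrightarrow> x \<in> L2 \<Longrightarrow> \<alpha> g x \<in> L2"
    using rdec unfolding rho_decomposition_def by blast+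
  obtain f where f: "bij_betw f L L1" "\<And>x y. x \<in> L \<Longrightarrow> y \<in> L \<Longrightarrow> f (x + y) = f x + f y"
    and f_equiv: "\<And>g x. g \<in> carrier G \<Longrightarrow> x \<in> L \<Longrightarrow> f (\<rho> g x) = \<alpha> g (f x)"
  proof -
    obtain f where "bij_betw f L L1 \<and> (\<forall>x\<in>L. \<forall>y\<in>L. f (x + y) = f x + f y) \<and>
        (\<forall>g\<in>carrier G. \<forall>x\<in>L. f (\<rho> g x) = \<alpha> g (f x))"
      using rdec[unfolded rho_decomposition_def ZG_isomorphic_def,
          THEN conjunct2, THEN conjunct2, THEN conjunct2] ..
    then show thesis by (intro that[of f]) simp_all
  qed
  have \<alpha>_linear: "Vector_Spaces.linear sW sW (\<alpha> g)"
    and \<alpha>_isometry: "\<And>x y. H (\<alpha> g x) (\<alpha> g y) = H x y" if "g \<in> carrier G" for g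
    using act that by (auto simp: ppav_action_def ppav_Aut_def ppav_iso_map_def hom_def Pi_def)
  have \<rho>_linear: "Vector_Spaces.linear sV sV (\<rho> g)" and \<rho>_image: "\<rho> g ` L = L"
    if "g \<in> carrier G" for g
    using assms(3) that by (auto simp: integral_representation_def lattice_Aut_def hom_def Pi_def)
  interpret W: hermitian_space sW H
    using assms(6) by (simp add: ppav_def hermitian_space_def hermitian_space_axioms_def)
  have full: "real_span sW \<Lambda> = UNIV"
    by (rule ppav_real_span[OF assms(6)])
  have L: "integral_structure sV n L" using assms(3) by (simp add: integral_representation_def)
  obtain S where V: "vector_space sV" and S: "finite S" "card S = n" "\<not> module.dependent sV S"
      "module.span sV S = UNIV" "L = module.span (zscale sV) S"
    using L unfolding integral_structure_def by blast
  interpret V: vector_space sV by (rule V)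
  interpret z: module "zscale sV" using V by (rule module_zscale)
  obtain F where F: "Vector_Spaces.linear sV sW F" "\<And>x. x \<in> L \<Longrightarrow> F x = f x"
    by (rule extend_additive_to_linear[OF L W.vector_space_axioms f(2)]) blast+
  interpret F: Vector_Spaces.linear sV sW F by (rule F(1))
  have F_equiv: "F (\<rho> g x) = \<alpha> g (F x)" if g: "g \<in> carrier G" for g x
  proof -
    have gL: "\<rho> g l \<in> L" if "l \<in> L" for l using \<rho>_image[OF g] that by blast
    have "(F \<circ> \<rho> g) x = (\<alpha> g \<circ> F) x"
    proof (rule linear_eq_on_integral_structure[OF L])
      show "(F \<circ> \<rho> g) l = (\<alpha> g \<circ> F) l" if "l \<in> L" for l
        using that gL by (simp add: F(2) f_equiv g)
    qed (rule Vector_Spaces.linear_compose F(1) \<rho>_linear[OF g] \<alpha>_linear[OF g])+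
    then show ?thesis by simp
  qed
  have FL: "F ` L = L1" using f(1) F(2) by (auto simp: bij_betw_def)
  \<comment> \<open>the kernel is invariant, and it is not everything because \<open>f\<close> is injective on \<open>L\<close>\<close>
  have "inj F"
  proof -
    let ?N = "{x. F x = 0}"
    have "V.subspace ?N" by (rule F.subspace_kernel)
    moreover have "\<rho> g ` ?N \<subseteq> ?N" if g: "g \<in> carrier G" for g
      using module_hom.zero[OF \<alpha>_linear[OF g, unfolded linear_iff_module_hom]]
      by (auto simp: F_equiv g)
    ultimately have "?N = {0} \<or> ?N = UNIV"
      using assms(5)[unfolded absolutely_irreducible_def, THEN conjunct2, THEN spec, of ?N] by blast
    moreover have "?N \<noteq> UNIV"
    proof
      assume "?N = UNIV"
      have "S \<subseteq> {0}"
      proof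
        fix b assume "b \<in> S"
        then have "b \<in> L" "0 \<in> L" by (simp_all add: S(5) z.span_base z.span_zero)
        moreover have "F x = 0" for x using \<open>?N = UNIV\<close> by blast
        ultimately have "f b = f 0" using F(2) by metis
        then show "b \<in> {0}" using f(1) \<open>b \<in> L\<close> \<open>0 \<in> L\<close> by (auto simp: bij_betw_def dest: inj_onD)
      qed
      then have "V.span S \<subseteq> {0}" by (rule V.span_minimal) simp
      then have "(UNIV :: 'v set) = {0}" unfolding S(4) by blast
      then show False using assms(5) unfolding absolutely_irreducible_def by blast
    qed
    ultimately show ?thesis unfolding F.inj_iff_eq_0 by blast
  qed
  moreover have "L1 \<subseteq> range F" using FL by blast
  ultimately have bij: "bij F"
    using bij_of_inj_covering_isotropic_summand[OF W.hermitian_space_axioms dec full L F(1)] by blast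
  \<comment> \<open>from here on everything takes place in \<open>V\<close>, where \<open>L1\<close> has become \<open>L\<close> itself\<close>
  define K where "K = inv_into UNIV F"
  have KF: "K (F x) = x" and FK: "F (K y) = y" for x y
    unfolding K_def using inv_f_f[OF bij_is_inj[OF bij]] surj_f_inv_f[OF bij_is_surj[OF bij]] by auto
  have K: "Vector_Spaces.linear sW sV K" "bij K"
    unfolding K_def using linear_inverse_of_bij[OF F(1) bij] bij_imp_bij_inv[OF bij] by auto
  interpret K: Vector_Spaces.linear sW sV K by (rule K(1))
  define H' where "H' x y = H (F x) (F y)" for x y
  define M where "M = K ` L2"
  define \<Lambda>' where "\<Lambda>' = K ` \<Lambda>"
  have iso: "ppav_iso_map sW \<Lambda> H sV \<Lambda>' H' K"
    by (simp add: ppav_iso_map_def K \<Lambda>'_def H'_def FK)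
  have X': "ppav sV m \<Lambda>' H'"
    by (rule ppav_iso_map_ppav[OF iso assms(6)])
  have "m = V.dim UNIV" using X' by (simp add: ppav_def)
  also have "\<dots> = n" using V.dim_eq_card[OF _ S(3), of UNIV] S(2,4) by simp
  finally have "m = n" .
  obtain B where B: "inner_product_on sV UNIV B" "invariant_form G \<rho> UNIV B" "integral_on L B"
    by (rule invariant_integral_inner_product[OF assms(1-3)]) blast
  have KL: "L = K ` L1" unfolding FL[symmetric] image_image KF by simp
  have dec': "decomposition sV \<Lambda>' H' L M"
  proof -
    interpret kz: module_hom "zscale sW" "zscale sV" K by (rule linear_restrict_scalars[OF K(1)])
    have "inj K" using K(2) by (simp add: bij_is_inj)
    have "L \<inter> M = {0}"
      using dec unfolding M_def KL image_Int[OF \<open>inj K\<close>, symmetric] by (simp add: decomposition_def)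
    moreover have "\<Lambda>' = {x + y |x y. x \<in> L \<and> y \<in> M}"
    proof -
      have "\<Lambda> = {x + y |x y. x \<in> L1 \<and> y \<in> L2}" using dec by (simp add: decomposition_def)
      then have "\<Lambda>' = {K (x + y) |x y. x \<in> L1 \<and> y \<in> L2}" unfolding \<Lambda>'_def by blast
      then show ?thesis unfolding KL M_def K.add by blast
    qed
    ultimately show ?thesis
      using dec kz.subspace_image
      by (auto simp: decomposition_def isotropic_on_def H'_def KL M_def FK)
  qed
  interpret equivariant_splitting sV H' G n L M \<Lambda>' \<rho> B
  proof unfold_locales
    show "hermitian_form sV H'" "pos_def_form H'" "unimodular_on \<Lambda>' (\<lambda>x y. Im (H' x y))"
      using X' by (simp_all add: ppav_def)
    show "real_span sV \<Lambda>' = UNIV" by (rule ppav_real_span[OF X'])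
    show "H' (\<rho> g x) (\<rho> g y) = H' x y" if "g \<in> carrier G" for g x y
      by (simp add: H'_def F_equiv \<alpha>_isometry that)
    show "\<rho> g x \<in> M" if g: "g \<in> carrier G" and x: "x \<in> M" for g x
    proof -
      obtain y where y: "y \<in> L2" "x = K y" using x by (auto simp: M_def)
      have "\<rho> g x = K (\<alpha> g y)" using F_equiv[OF g, of x] by (metis KF FK y(2))
      then show ?thesis using inv2[OF g y(1)] by (simp add: M_def)
    qed
  qed (fact assms dec' B)+
  obtain \<tau> where \<tau>: "Im \<tau> > 0" "X_form sV L B \<tau> H'" "X_lattice sV L B \<tau> = \<Lambda>'"
    by (rule splitting_eq_X)
  show ?thesis
  proof (intro exI conjI)
    show "inner_product_on sV (real_span sV L) B"
      unfolding inner_product_on_def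
      by (intro conjI ballI allI impI B_add_left B_rscale_left B_sym B_pos)
    show "invariant_form G \<rho> (real_span sV L) B"
      using B(2) by (simp add: invariant_form_def)
    show "ppav sV n (X_lattice sV L B \<tau>) H'" using X' \<open>m = n\<close> \<tau>(3) by simp
    show "ppav_isomorphic sW \<Lambda> H sV (X_lattice sV L B \<tau>) H'"
      unfolding ppav_isomorphic_def \<tau>(3) using iso by blast
  qed (fact B(3) \<tau>)+
qed

end
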